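(* Let $\lambda\in\mathbb{R}$ with $\lambda\neq0$, and let $\mathcal{R}\colon\mathcal{H}_d\to\mathcal{H}_d$ be an $\mathbb{R}$-linear map on the dual quaternion algebra. Then $\mathcal{R}$ is a Rota-Baxter operator of weight $\lambda$ on $\mathcal{H}_d$ if and only if its matrix $R$ with respect to the basis $\{e_0,e_1,e_2,e_3\}$ has the form $$R=\begin{pmatrix}\alpha&\mathbf{0}^T\\ \mathbf{0}&A\end{pmatrix},\qquad \alpha\in\{0,-\lambda\},\qquad A^2+\lambda A=0,$$ where $A$ is a real $3\times 3$ matrix.
   Context: The dual quaternion algebra $\mathcal{H}_d$ is the 4-dimensional commutative associative unital $\mathbb{R}$-algebra with basis $e_0,e_1,e_2,e_3$, where $e_0$ is the identity and $e_ie_j=0$ for all $i,j\in\{1,2,3\}$; that is, $x\cdot y=x_0y_0e_0+\sum_{i=1}^3(x_0y_i+y_0x_i)e_i$ for $x=\sum_{i=0}^3 x_ie_i$, $y=\sum_{i=0}^3 y_ie_i$. For $\lambda\in\mathbb{R}$, a Rota-Baxter operator of weight $\lambda$ on an $\mathbb{R}$-algebra $B$ is an $\mathbb{R}$-linear map $\mathcal{R}\colon B\to B$ such that $\mathcal{R}(x)\mathcal{R}(y)=\mathcal{R}(\mathcal{R}(x)y)+\mathcal{R}(x\mathcal{R}(y))+\lambda\mathcal{R}(xy)$ for all $x,y\in B$. The matrix $R$ of $\mathcal{R}$ is the $4\times 4$ real matrix whose columns are, in order, the coordinate vectors of $\mathcal{R}(e_0),\mathcal{R}(e_1),\mathcal{R}(e_2),\mathcal{R}(e_3)$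 in the basis $\{e_0,e_1,e_2,e_3\}$. $\mathbf{0}$ denotes the zero column vector in $\mathbb{R}^3$. *)

theory Defs
  imports Complex_Main "Jordan_Normal_Form.Matrix"
begin

text \<open>The fields of \<open>DualQuat\<close> are the coordinates in the basis \<open>e\<^sub>0, e\<^sub>1, e\<^sub>2, e\<^sub>3\<close>.\<close>

datatype dual_quaternion = DualQuat (dq0: real) (dq1: real) (dq2: real) (dq3: real)

lemma dual_quaternion_eq_iff:
  "x = y \<longleftrightarrow> dq0 x = dq0 y \<and> dq1 x = dq1 y \<and> dq2 x = dq2 y \<and> dq3 x = dq3 y"
  by (cases x; cases y) simp

instantiation dual_quaternion :: "{comm_ring_1, real_algebra_1}"
begin

definition zero_dual_quaternion :: dual_quaternion where
  "0 = DualQuat 0 0 0 0"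

definition one_dual_quaternion :: dual_quaternion where
  "1 = DualQuat 1 0 0 0"

definition plus_dual_quaternion :: "dual_quaternion \<Rightarrow> dual_quaternion \<Rightarrow> dual_quaternion" where
  "x + y = DualQuat (dq0 x + dq0 y) (dq1 x + dq1 y) (dq2 x + dq2 y) (dq3 x + dq3 y)"

definition uminus_dual_quaternion :: "dual_quaternion \<Rightarrow> dual_quaternion" where
  "- x = DualQuat (- dq0 x) (- dq1 x) (- dq2 x) (- dq3 x)"

definition minus_dual_quaternion :: "dual_quaternion \<Rightarrow> dual_quaternion \<Rightarrow> dual_quaternion" where
  "x - y = DualQuat (dq0 x - dq0 y) (dq1 x - dq1 y) (dq2 x - dq2 y) (dq3 x - dq3 y)"

definition scaleR_dual_quaternion :: "real \<Rightarrow> dual_quaternion \<Rightarrow> dual_quaternion" where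
  "c *\<^sub>R x = DualQuat (c * dq0 x) (c * dq1 x) (c * dq2 x) (c * dq3 x)"

definition times_dual_quaternion :: "dual_quaternion \<Rightarrow> dual_quaternion \<Rightarrow> dual_quaternion" where
  "x * y = DualQuat (dq0 x * dq0 y)
                    (dq0 x * dq1 y + dq0 y * dq1 x)
                    (dq0 x * dq2 y + dq0 y * dq2 x)
                    (dq0 x * dq3 y + dq0 y * dq3 x)"

instance
  by standard
    (simp_all add: dual_quaternion_eq_iff zero_dual_quaternion_def one_dual_quaternion_def
      plus_dual_quaternion_def uminus_dual_quaternion_def minus_dual_quaternion_def
      scaleR_dual_quaternion_def times_dual_quaternion_def algebra_simps)

end

text \<open>The basis \<open>e\<^sub>i\<close>; only the indices \<open>i < 4\<close> are meaningful.\<close>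

definition dq_basis :: "nat \<Rightarrow> dual_quaternion" where
  "dq_basis i = DualQuat (of_bool (i = 0)) (of_bool (i = 1)) (of_bool (i = 2)) (of_bool (i = 3))"

definition dq_coords :: "dual_quaternion \<Rightarrow> real vec" where
  "dq_coords x = vec_of_list [dq0 x, dq1 x, dq2 x, dq3 x]"

lemma dq_basis_0: "dq_basis 0 = 1"
  by (simp add: dq_basis_def one_dual_quaternion_def)

lemma dq_basis_mult_eq_0:
  assumes "i \<in> {1, 2, 3}" and "j \<in> {1, 2, 3}"
  shows "dq_basis i * dq_basis j = 0"
  using assms by (auto simp: dq_basis_def times_dual_quaternion_def zero_dual_quaternion_def)

lemma dq_basis_expansion: "x = (\<Sum>i<4. (dq_coords x $ i) *\<^sub>R dq_basis i)"
  by (simp add: eval_nat_numeral dq_coords_def dq_basis_def dual_quaternion_eq_iff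
      scaleR_dual_quaternion_def plus_dual_quaternion_def zero_dual_quaternion_def)

lemma dq_coords_dq_basis: "i < 4 \<Longrightarrow> dq_coords (dq_basis i) = unit_vec 4 i"
  by (intro eq_vecI)
    (auto simp: dq_coords_def dq_basis_def unit_vec_def less_Suc_eq eval_nat_numeral)

definition dq_matrix :: "(dual_quaternion \<Rightarrow> dual_quaternion) \<Rightarrow> real mat" where
  "dq_matrix f = mat_of_cols 4 (map (\<lambda>j. dq_coords (f (dq_basis j))) [0, 1, 2, 3])"

definition rota_baxter_operator :: "real \<Rightarrow> ('a::real_algebra \<Rightarrow> 'a) \<Rightarrow> bool" where
  "rota_baxter_operator lam f \<longleftrightarrow> linear f \<and>
     (\<forall>x y. f x * f y = f (f x * y) + f (x * f y) + lam *\<^sub>R f (x * y))"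

end

theory Submission imports Defs begin

text \<open>Write \<open>x = s + u\<close> with \<open>s\<close> real and \<open>u\<close> pure, i.e. of vanishing \<open>e\<^sub>0\<close>-coordinate; pure elements
  multiply to zero. For pure \<open>u\<close> the Rota--Baxter identity at \<open>(u, u)\<close> forces \<open>R u\<close> to be pure, the
  identity at \<open>(1, u)\<close> then says \<open>R (R u) = - lam R u\<close>, and the identity at \<open>(1, 1)\<close> yields a quadratic
  equation for the real part of \<open>R 1\<close> as well as \<open>2 R v = - lam v\<close> for its pure part \<open>v\<close>. The
  eigenvalue \<open>- lam / 2\<close> contradicts \<open>R (R v) = - lam R v\<close> unless \<open>v = 0\<close>. Hence the Rota--Baxter
  operators of weight \<open>lam\<close> are the block diagonal maps with \<open>R\<^sup>2 + lam R = 0\<close>.\<close>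

section \<open>Arithmetic of real and pure parts\<close>

lemmas dual_quaternion_defs =
  zero_dual_quaternion_def one_dual_quaternion_def plus_dual_quaternion_def
  uminus_dual_quaternion_def minus_dual_quaternion_def scaleR_dual_quaternion_def
  times_dual_quaternion_def

lemma dq0_simps [simp]:
  "dq0 0 = 0" "dq0 1 = 1" "dq0 (x + y) = dq0 x + dq0 y" "dq0 (x - y) = dq0 x - dq0 y"
  "dq0 (- x) = - dq0 x" "dq0 (c *\<^sub>R x) = c * dq0 x" "dq0 (x * y) = dq0 x * dq0 y"
  by (simp_all add: dual_quaternion_defs)

lemma dq0_numeral [simp]: "dq0 (numeral n) = numeral n"
  by (induction n) (simp_all only: numeral.simps dq0_simps)

lemma pure_coordinate_simps:
  "dq1 0 = 0" "dq2 0 = 0" "dq3 0 = 0" "dq1 1 = 0" "dq2 1 = 0" "dq3 1 = 0"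
  "dq1 (x + y) = dq1 x + dq1 y" "dq2 (x + y) = dq2 x + dq2 y" "dq3 (x + y) = dq3 x + dq3 y"
  "dq1 (x - y) = dq1 x - dq1 y" "dq2 (x - y) = dq2 x - dq2 y" "dq3 (x - y) = dq3 x - dq3 y"
  "dq1 (c *\<^sub>R x) = c * dq1 x" "dq2 (c *\<^sub>R x) = c * dq2 x" "dq3 (c *\<^sub>R x) = c * dq3 x"
  by (simp_all add: dual_quaternion_defs)

lemma mult_pure_right: "dq0 u = 0 \<Longrightarrow> x * u = dq0 x *\<^sub>R u" for x u :: dual_quaternion
  by (simp add: dual_quaternion_defs)

lemma mult_pure_left: "dq0 u = 0 \<Longrightarrow> u * x = dq0 x *\<^sub>R u" for x u :: dual_quaternion
  by (simp add: dual_quaternion_defs)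

lemma dual_quaternion_decomp:
  obtains u where "dq0 u = 0" and "x = dq0 x *\<^sub>R 1 + u"
  by (rule that[of "x - dq0 x *\<^sub>R 1"]) simp_all

text \<open>Coordinate-free form of the classification, split so that the first conjunct can later
  become a matrix equation and the other two the vanishing of the off-diagonal blocks.\<close>

lemma rota_baxter_operator_dual_quaternion_iff:
  fixes R :: "dual_quaternion \<Rightarrow> dual_quaternion"
  assumes lam: "lam \<noteq> 0" and lin: "linear R"
  shows "rota_baxter_operator lam R \<longleftrightarrow>
    (\<forall>x. R (R x) + lam *\<^sub>R R x = 0) \<and> R 1 = dq0 (R 1) *\<^sub>R 1 \<and> (\<forall>u. dq0 u = 0 \<longrightarrow> dq0 (R u) = 0)"
    (is "_ \<longleftrightarrow> ?rhs")
proof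
  note R_simps = linear_add[OF lin] linear_scale[OF lin] linear_0[OF lin]
  assume "rota_baxter_operator lam R"
  then have rb: "R x * R y = R (R x * y) + R (x * R y) + lam *\<^sub>R R (x * y)" for x y
    by (simp add: rota_baxter_operator_def)
  have pure: "dq0 (R u) = 0" if "dq0 u = 0" for u
  proof -
    have "R u * R u = dq0 (R u) *\<^sub>R R u + dq0 (R u) *\<^sub>R R u"
      using rb[of u u] that by (simp only: mult_pure_right mult_pure_left R_simps) simp
    \<comment> \<open>With r = \<open>dq0 (R u)\<close>, the real parts give r^2 = 2 r^2, hence r =
      0.\<close>
    from arg_cong[OF this, of dq0] show ?thesis
      by (simp only: dq0_simps) simp
  qed
  have square: "R (R u) + lam *\<^sub>R R u = 0" if "dq0 u = 0" for u
  proof -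
    \<comment> \<open>Since \<open>u\<close> and \<open>R u\<close> are pure, both
      \<open>R 1 * R u\<close> and \<open>R (R 1 * u)\<close> reduce to the same multiple of
      \<open>R u\<close> and cancel.\<close>
    have "dq0 (R 1) *\<^sub>R R u = dq0 (R 1) *\<^sub>R R u + R (R u) + lam *\<^sub>R R u"
      using rb[of 1 u] by (simp only: mult_pure_right that pure R_simps mult_1_left)
    then show ?thesis by simp
  qed
  obtain v where v: "dq0 v = 0" and R1: "R 1 = dq0 (R 1) *\<^sub>R 1 + v"
    by (rule dual_quaternion_decomp)
  \<comment> \<open>Naming the coefficient removes \<open>R 1\<close> from the right-hand side of
    its own equation, which can then be unfolded without looping.\<close>
  define a where "a = dq0 (R 1)"
  have R1: "R 1 = a *\<^sub>R 1 + v"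
    using R1 unfolding a_def .
  have RR1: "R (R 1) = (a * a) *\<^sub>R 1 + a *\<^sub>R v + R v"
    by (subst R1) (simp only: R_simps R1 scaleR_add_right scaleR_scaleR)
  have sq1: "R 1 * R 1 = (a * a) *\<^sub>R 1 + a *\<^sub>R v + a *\<^sub>R v"
    unfolding R1
    by (simp only: distrib_left distrib_right mult_pure_right[OF v] mult_pure_left[OF v] v
        mult_scaleR_left mult_scaleR_right scaleR_scaleR scaleR_add_right mult_1_left mult_1_right
        dq0_simps v add_0_right add.assoc)
  have one: "R 1 * R 1 = R (R 1) + R (R 1) + lam *\<^sub>R R 1"
    using rb[of 1 1] by (simp only: mult_1_left mult_1_right)
  \<comment> \<open>Real parts of \<open>one\<close>: a^2 = 2 a^2 + lam a.\<close>
  have a: "a * a + lam * a = 0"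
    using arg_cong[OF one[unfolded RR1 sq1], of dq0] unfolding R1 by (simp add: v pure[OF v])
  have "R v + R v + lam *\<^sub>R v + (a * a + lam * a) *\<^sub>R 1 = 0"
    using one[unfolded RR1 sq1] unfolding R1
    by (simp only: dual_quaternion_eq_iff dq0_simps pure_coordinate_simps)
        (simp add: algebra_simps)
  then have "R v + R v + lam *\<^sub>R v = 0"
    using a by simp
  moreover from arg_cong[OF this, of R] have "R (R v) + R (R v) + lam *\<^sub>R R v = 0"
    by (simp only: R_simps)
  \<comment> \<open>Subtracting \<open>square\<close> from 2 R(R v) + lam R v = 0 twice leaves lam R
    v = 0. As lam is nonzero, R v = 0, and then 2 R v + lam v = 0 forces v = 0.\<close>
  then have "lam *\<^sub>R R v = 0"
    using square[OF v] by (metis add.assoc add.right_neutral add_left_cancel)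
  ultimately have "v = 0"
    using lam by simp
  then have R1: "R 1 = a *\<^sub>R 1"
    using R1 by simp
  have "R (R x) + lam *\<^sub>R R x = 0" for x
  proof -
    obtain u where u: "dq0 u = 0" and x: "x = dq0 x *\<^sub>R 1 + u"
      by (rule dual_quaternion_decomp)
    have "R (R x) + lam *\<^sub>R R x = dq0 x *\<^sub>R (a * a + lam * a) *\<^sub>R 1 + (R (R u) + lam *\<^sub>R R u)"
      by (subst (1 2) x) (simp add: R_simps R1 algebra_simps)
    then show ?thesis
      using a square[OF u] by simp
  qed
  then show ?rhs
    using pure R1 by (simp add: a_def)
next
  note R_simps = linear_add[OF lin] linear_scale[OF lin] linear_0[OF lin]
  assume rhs: ?rhs
  define a where "a = dq0 (R 1)"
  have R1: "R 1 = a *\<^sub>R 1" and pure: "dq0 u = 0 \<Longrightarrow> dq0 (R u) = 0" for u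
    using rhs by (auto simp: a_def)
  have square: "R (R x) = - lam *\<^sub>R R x" for x
    using rhs by (simp add: eq_neg_iff_add_eq_0)
  have a: "a * a = - lam * a"
    using arg_cong[OF square[of 1], of dq0] by (simp add: R1 R_simps)
  have "R x * R y = R (R x * y) + R (x * R y) + lam *\<^sub>R R (x * y)" for x y
  proof -
    obtain u where u: "dq0 u = 0" and x: "x = dq0 x *\<^sub>R 1 + u"
      by (rule dual_quaternion_decomp)
    obtain w where w: "dq0 w = 0" and y: "y = dq0 y *\<^sub>R 1 + w"
      by (rule dual_quaternion_decomp)
    \<comment> \<open>As with \<open>a\<close>, fresh names keep the decompositions of
      \<open>x\<close> and \<open>y\<close> usable as rewrite rules.\<close>
    define s t where "s = dq0 x" and "t = dq0 y"
    have x: "x = s *\<^sub>R 1 + u" and y: "y = t *\<^sub>R 1 + w"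
      using x y by (simp_all add: s_def t_def)
    have pures: "dq0 u = 0" "dq0 w = 0" "dq0 (R u) = 0" "dq0 (R w) = 0"
      using u w pure by auto
    note mult_simps = distrib_left distrib_right mult_pure_right mult_pure_left pures
      dq0_simps scaleR_add_right scaleR_scaleR mult_scaleR_left mult_scaleR_right
      mult_1_left mult_1_right scaleR_zero_left mult_zero_left mult_zero_right add_0_right
    have Rx: "R x = (s * a) *\<^sub>R 1 + R u" and Ry: "R y = (t * a) *\<^sub>R 1 + R w"
      by (simp_all add: x y R_simps R1)
    have "R x * R y = (s * t * (a * a)) *\<^sub>R 1 + (s * a) *\<^sub>R R w + (t * a) *\<^sub>R R u"
      unfolding Rx Ry by (simp add: mult_simps ac_simps)
    moreover have "R x * y = (s * t * a) *\<^sub>R 1 + (s * a) *\<^sub>R w + t *\<^sub>R R u"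
      unfolding Rx y by (simp add: mult_simps ac_simps)
    then have "R (R x * y) = (s * t * (a * a)) *\<^sub>R 1 + (s * a) *\<^sub>R R w - (lam * t) *\<^sub>R R u"
      by (simp add: R_simps R1 square ac_simps)
    moreover have "x * R y = (s * t * a) *\<^sub>R 1 + s *\<^sub>R R w + (t * a) *\<^sub>R u"
      unfolding Ry x by (simp add: mult_simps ac_simps)
    then have "R (x * R y) = (s * t * (a * a)) *\<^sub>R 1 - (lam * s) *\<^sub>R R w + (t * a) *\<^sub>R R u"
      by (simp add: R_simps R1 square ac_simps)
    moreover have "x * y = (s * t) *\<^sub>R 1 + s *\<^sub>R w + t *\<^sub>R u"
      unfolding x y by (simp add: mult_simps ac_simps)
    then have "R (x * y) = (s * t * a) *\<^sub>R 1 + s *\<^sub>R R w + t *\<^sub>R R u"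
      by (simp add: R_simps R1)
    \<comment> \<open>Compare coefficients: on \<open>R u\<close> and \<open>R w\<close> the -lam
      terms produced by \<open>square\<close> cancel against the weight term, and on 1 the equation
      a^2 = -lam a gives 2 a^2 + lam a = a^2.\<close>
    ultimately show ?thesis
      by (simp only: dual_quaternion_eq_iff dq0_simps pure_coordinate_simps)
        (simp add: a algebra_simps)
  qed
  then show "rota_baxter_operator lam R"
    using lin by (simp add: rota_baxter_operator_def)
qed

section \<open>From linear maps to matrices\<close>

lemma dq_matrix_carrier [simp]: "dq_matrix f \<in> carrier_mat 4 4"
  unfolding dq_matrix_def by (rule carrier_matI) simp_all

lemma dim_dq_matrix [simp]: "dim_row (dq_matrix f) = 4" "dim_col (dq_matrix f) = 4"
  using dq_matrix_carrier by (auto simp del: dq_matrix_carrier)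

lemma dq_matrix_index:
  assumes "i < 4" and "j < 4"
  shows "dq_matrix f $$ (i, j) = dq_coords (f (dq_basis j)) $ i"
  using assms unfolding dq_matrix_def
  by (auto simp: mat_of_cols_index less_Suc_eq eval_nat_numeral)

lemma linear_dq_coords:
  assumes "i < 4"
  shows "linear (\<lambda>x. dq_coords x $ i)"
  by (rule linearI)
    (use assms in \<open>auto simp: dq_coords_def dual_quaternion_defs less_Suc_eq eval_nat_numeral\<close>)

text \<open>Expanding \<open>x\<close> in the basis shows that \<open>f\<close> acts on coordinate
  columns through its matrix; composition therefore becomes the matrix product below.\<close>

lemma dq_coords_linear:
  assumes "linear f" and "i < 4"
  shows "dq_coords (f x) $ i = (\<Sum>k<4. dq_coords (f (dq_basis k)) $ i * dq_coords x $ k)"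
proof -
  interpret linear "\<lambda>x. dq_coords (f x) $ i"
    using linear_compose[OF assms(1) linear_dq_coords[OF assms(2)]] by (simp add: o_def)
  show ?thesis
    by (subst dq_basis_expansion) (simp add: sum scale mult.commute)
qed

lemma dq_matrix_compose:
  assumes "linear f"
  shows "dq_matrix (\<lambda>x. f (g x)) = dq_matrix f * dq_matrix g"
proof (rule eq_matI)
  fix i j assume "i < dim_row (dq_matrix f * dq_matrix g)" "j < dim_col (dq_matrix f * dq_matrix g)"
  then have "i < 4" "j < 4" by simp_all
  then show "dq_matrix (\<lambda>x. f (g x)) $$ (i, j) = (dq_matrix f * dq_matrix g) $$ (i, j)"
    by (simp add: dq_matrix_index dq_coords_linear[OF assms, of _ "g _"] scalar_prod_def
        lessThan_atLeast0)
qed simp_all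

lemma dq_matrix_add: "dq_matrix (\<lambda>x. f x + g x) = dq_matrix f + dq_matrix g"
  by (rule eq_matI) (simp_all add: dq_matrix_index linear_add[OF linear_dq_coords])

lemma dq_matrix_scaleR: "dq_matrix (\<lambda>x. c *\<^sub>R f x) = c \<cdot>\<^sub>m dq_matrix f"
  by (rule eq_matI) (simp_all add: dq_matrix_index linear_scale[OF linear_dq_coords])

lemma dq_coords_eq_0: "(\<And>i. i < 4 \<Longrightarrow> dq_coords x $ i = 0) \<Longrightarrow> x = 0"
  by (subst dq_basis_expansion) simp

text \<open>A linear map is determined by its values on the basis, so an operator identity can be
  tested on matrices.\<close>

lemma dq_matrix_eq_0_iff:
  assumes "linear f"
  shows "dq_matrix f = 0\<^sub>m 4 4 \<longleftrightarrow> (\<forall>x. f x = 0)"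
proof
  assume zero: "dq_matrix f = 0\<^sub>m 4 4"
  have "dq_coords (f (dq_basis j)) $ i = 0" if "i < 4" "j < 4" for i j
    using dq_matrix_index[OF that, of f] that by (simp add: zero)
  then show "\<forall>x. f x = 0"
    by (intro allI dq_coords_eq_0) (subst dq_coords_linear[OF assms], simp_all)
next
  assume "\<forall>x. f x = 0"
  then show "dq_matrix f = 0\<^sub>m 4 4"
    by (intro eq_matI) (simp_all add: dq_matrix_index linear_0[OF linear_dq_coords])
qed

section \<open>Block diagonal matrices\<close>

lemma diag_block_mat_square_smult_eq_0_iff:
  fixes c \<alpha> :: "'a :: idom"
  assumes A: "A \<in> carrier_mat n n"
  defines "M \<equiv> four_block_mat (mat 1 1 (\<lambda>_. \<alpha>)) (0\<^sub>m 1 n) (0\<^sub>m n 1) A"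
  shows "M * M + c \<cdot>\<^sub>m M = 0\<^sub>m (Suc n) (Suc n) \<longleftrightarrow> \<alpha> \<in> {0, - c} \<and> A ^\<^sub>m 2 + c \<cdot>\<^sub>m A = 0\<^sub>m n n"
proof -
  let ?a = "mat 1 1 (\<lambda>_. \<alpha>)" and ?B = "A ^\<^sub>m 2 + c \<cdot>\<^sub>m A"
  have B: "?B \<in> carrier_mat n n"
    using A by simp
  have a: "?a * ?a + c \<cdot>\<^sub>m ?a = mat 1 1 (\<lambda>_. \<alpha> * \<alpha> + c * \<alpha>)"
    by (rule eq_matI) (auto simp: scalar_prod_def)
  have MM: "M * M = four_block_mat (?a * ?a) (0\<^sub>m 1 n) (0\<^sub>m n 1) (A * A)"
    unfolding M_def
    by (subst mult_four_block_mat[where ?nr1.0 = 1 and ?nr2.0 = n and ?n1.0 = 1 and ?n2.0 = n])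
      (use A in auto)
  have cM: "c \<cdot>\<^sub>m M = four_block_mat (c \<cdot>\<^sub>m ?a) (0\<^sub>m 1 n) (0\<^sub>m n 1) (c \<cdot>\<^sub>m A)"
    unfolding M_def
    by (subst smult_four_block_mat[where ?nr1.0 = 1 and ?nr2.0 = n and ?nc1.0 = 1 and ?nc2.0 = n])
      (use A in auto)
  have eq: "M * M + c \<cdot>\<^sub>m M = four_block_mat (mat 1 1 (\<lambda>_. \<alpha> * \<alpha> + c * \<alpha>)) (0\<^sub>m 1 n) (0\<^sub>m n 1) ?B"
    unfolding MM cM a[symmetric]
    by (subst add_four_block_mat[where ?nr1.0 = 1 and ?nr2.0 = n and ?nc1.0 = 1 and ?nc2.0 = n])
      (use A in \<open>auto simp: numeral_2_eq_2\<close>)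
  have "M * M + c \<cdot>\<^sub>m M = 0\<^sub>m (Suc n) (Suc n) \<longleftrightarrow> \<alpha> * \<alpha> + c * \<alpha> = 0 \<and> ?B = 0\<^sub>m n n" (is "?l = ?r")
  proof
    assume zero: ?l
    have "(M * M + c \<cdot>\<^sub>m M) $$ (0, 0) = \<alpha> * \<alpha> + c * \<alpha>"
      unfolding eq using carrier_matD[OF A] by simp
    \<comment> \<open>The scalar block occupies index 0, so the lower right block is shifted by
      one.\<close>
    moreover have "(M * M + c \<cdot>\<^sub>m M) $$ (Suc i, Suc j) = ?B $$ (i, j)" if "i < n" "j < n" for i j
      unfolding eq using carrier_matD[OF A] that by simp
    ultimately show ?r
      unfolding zero using B by (intro conjI eq_matI) auto
  next
    assume ?r
    then show ?l
      unfolding eq by (intro eq_matI) auto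
  qed
  \<comment> \<open>The left side factors as (\<alpha> + c) \<alpha>, and there are no zero
    divisors.\<close>
  also have "\<alpha> * \<alpha> + c * \<alpha> = 0 \<longleftrightarrow> \<alpha> \<in> {0, - c}"
    by (auto simp: distrib_right[symmetric] add_eq_0_iff2)
  finally show ?thesis .
qed

text \<open>The zero block in the first column says that \<open>R 1\<close> is real; the zero block
  in the first row says that the images of the three pure basis elements are pure, which extends to
  all pure elements by linearity.\<close>

lemma dq_matrix_eq_diag_block_iff:
  assumes lin: "linear R"
  shows "(\<exists>\<alpha>. \<exists>A \<in> carrier_mat 3 3. dq_matrix R = four_block_mat (mat 1 1 (\<lambda>_. \<alpha>)) (0\<^sub>m 1 3) (0\<^sub>m 3 1) A)
    \<longleftrightarrow> R 1 = dq0 (R 1) *\<^sub>R 1 \<and> (\<forall>u. dq0 u = 0 \<longrightarrow> dq0 (R u) = 0)"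
    (is "?l = ?r")
proof
  have coords0: "dq_coords x $ 0 = dq0 x" for x
    by (simp add: dq_coords_def)
  {
    assume ?l
    then obtain \<alpha> A where A: "A \<in> carrier_mat 3 3"
      and M: "dq_matrix R = four_block_mat (mat 1 1 (\<lambda>_. \<alpha>)) (0\<^sub>m 1 3) (0\<^sub>m 3 1) A"
      by blast
    have col: "dq_coords (R 1) $ i = 0" if "i \<in> {1, 2, 3}" for i
      using dq_matrix_index[of i 0 R] that A by (auto simp: M dq_basis_0)
    have row: "dq0 (R (dq_basis j)) = 0" if "j \<in> {1, 2, 3}" for j
      using dq_matrix_index[of 0 j R] that A by (auto simp: M coords0)
    have "dq0 (R u) = 0" if "dq0 u = 0" for u
      using dq_coords_linear[OF lin, of 0 u] row that
      by (simp add: coords0 eval_nat_numeral)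
    moreover have "R 1 = dq0 (R 1) *\<^sub>R 1"
      using col[of 1] col[of 2] col[of 3]
      by (simp add: dq_coords_def dual_quaternion_eq_iff dual_quaternion_defs eval_nat_numeral)
    ultimately show ?r by blast
  }
  assume r: ?r
  define A where "A = mat 3 3 (\<lambda>(i, j). dq_matrix R $$ (Suc i, Suc j))"
  have col: "dq_matrix R $$ (i, 0) = 0" if "0 < i" "i < 4" for i
    using r that
    by (subst dq_matrix_index)
      (auto simp: dq_basis_0 dq_coords_def dual_quaternion_eq_iff dual_quaternion_defs
        less_Suc_eq eval_nat_numeral)
  have row: "dq_matrix R $$ (0, j) = 0" if "0 < j" "j < 4" for j
  proof -
    have "dq0 (dq_basis j) = 0"
      using that by (simp add: dq_basis_def)
    then show ?thesis
      using r that by (simp add: dq_matrix_index coords0)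
  qed
  have "dq_matrix R = four_block_mat (mat 1 1 (\<lambda>_. dq_matrix R $$ (0, 0))) (0\<^sub>m 1 3) (0\<^sub>m 3 1) A"
    by (rule eq_matI) (auto simp: A_def col row)
  moreover have "A \<in> carrier_mat 3 3"
    by (simp add: A_def)
  ultimately show ?l by blast
qed

theorem theorem4p2:
  fixes lam :: real and R :: "dual_quaternion \<Rightarrow> dual_quaternion"
  assumes "lam \<noteq> 0" and "linear R"
  shows "rota_baxter_operator lam R \<longleftrightarrow>
    (\<exists>\<alpha> A. \<alpha> \<in> {0, - lam} \<and> A \<in> carrier_mat 3 3 \<and>
       A ^\<^sub>m 2 + lam \<cdot>\<^sub>m A = 0\<^sub>m 3 3 \<and>
       dq_matrix R = four_block_mat (mat 1 1 (\<lambda>_. \<alpha>)) (0\<^sub>m 1 3) (0\<^sub>m 3 1) A)"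
proof -
  let ?M = "dq_matrix R"
  let ?F = "\<lambda>\<alpha> A. four_block_mat (mat 1 1 (\<lambda>_. \<alpha>)) (0\<^sub>m 1 3) (0\<^sub>m 3 1) A"
  have "linear (\<lambda>x. R (R x) + lam *\<^sub>R R x)"
    using linear_compose_add[OF linear_compose[OF assms(2) assms(2)]
        linear_compose_scale_right[OF assms(2)]] by (simp only: o_def)
  then have "(\<forall>x. R (R x) + lam *\<^sub>R R x = 0) \<longleftrightarrow> ?M * ?M + lam \<cdot>\<^sub>m ?M = 0\<^sub>m 4 4"
    by (subst dq_matrix_eq_0_iff[symmetric])
      (simp_all add: dq_matrix_add dq_matrix_scaleR dq_matrix_compose[OF assms(2), of R])
  then have "rota_baxter_operator lam R \<longleftrightarrow>
      ?M * ?M + lam \<cdot>\<^sub>m ?M = 0\<^sub>m 4 4 \<and> (\<exists>\<alpha>. \<exists>A \<in> carrier_mat 3 3. ?M = ?F \<alpha> A)"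
    by (simp only: rota_baxter_operator_dual_quaternion_iff[OF assms]
        dq_matrix_eq_diag_block_iff[OF assms(2)])
  \<comment> \<open>Substituting the block form for the matrix puts the quadratic equation under the
    quantifiers, where it can be split blockwise.\<close>
  also have "\<dots> \<longleftrightarrow> (\<exists>\<alpha> A. A \<in> carrier_mat 3 3 \<and> ?M = ?F \<alpha> A \<and>
      ?F \<alpha> A * ?F \<alpha> A + lam \<cdot>\<^sub>m ?F \<alpha> A = 0\<^sub>m 4 4)"
    by metis
  also have "\<dots> \<longleftrightarrow> (\<exists>\<alpha> A. \<alpha> \<in> {0, - lam} \<and> A \<in> carrier_mat 3 3 \<and>
      A ^\<^sub>m 2 + lam \<cdot>\<^sub>m A = 0\<^sub>m 3 3 \<and> ?M = ?F \<alpha> A)"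
    using diag_block_mat_square_smult_eq_0_iff[of _ 3 _ lam] by (auto simp: eval_nat_numeral)
  finally show ?thesis .
qed

end
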